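(* Let $m \ge 3$ and let $V_0^{(0)}=\emptyset$ (every vertex of $P(m,1)$ has weight $1$). Then $$\mathcal{G}(\{P(m,1),V_0^{(0)}\}) = \mathrm{mex}\{x_1,x_2,\dots,x_{2m}\},$$ where $x_i = \mathcal{G}(\mathcal{H}_{m+1})$ for all $i \in \{1,2,\dots,2m\}$.
   Context: Toggle: Let $G$ be a finite simple graph, with $N[v]$ the closed neighborhood of $v$. A position $\{G,V_0\}$ consists of $G$ and a set $V_0\subseteq V(G)$ of vertices of weight $0$; all other vertices have weight $1$. Let $\sigma(v)$ be the sum of the weights of the vertices in $N[v]$. A legal move consists of choosing a vertex $v$ of weight $1$ and switching the weight ($0\leftrightarrow 1$) of every vertex of $N[v]$; it is allowed only if $\sigma(v)$ after the switch is strictly smaller than $\sigma(v)$ before it. Two players alternate legal moves; a player with no legal move loses. Nimbers: $\mathcal{G}(\mathcal{S})=\mathrm{mex}\{\mathcal{G}(\mathcal{S}') : \mathcal{S}' \text{ reachable from } \mathcal{S} \text{ by one legal move}\}$, where $\mathrm{mex}(T)$ is the least nonnegative integer not in the finite set $T$ (so $\mathrm{mex}(\emptyset)=0$). $\mathcal{L}_{2,m}$ is the $2\times m$ grid graph with vertices $v_{i,j}$, $0\le i\le 1$, $1\le j\le m$, with edges $v_{0,j}v_{1,j}$ and $v_{i,j}v_{i,j+1}$ ($1\le j<m$). For $m\ge 3$, $P(m,1)$ is the graph obtained from $\mathcal{L}_{2,m}$ by adding the edges $v_{0,1}v_{0,m}$ and $v_{1,1}v_{1,m}$. For $m\ge 4$,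 $\mathcal{H}_m=\{\mathcal{L}_{2,m},V_0\}$ with $V_0=\{v_{0,1},v_{0,m},v_{1,1},v_{1,2},v_{1,m-1},v_{1,m}\}$. *)

theory Defs
  imports "Graph_Theory.Graph_Theory"
begin

text \<open>
  A finite simple graph is a \<^typ>\<open>'a pair_pre_digraph\<close> satisfying \<^locale>\<open>pair_graph\<close>:
  finitely many vertices, no loops, and each edge present as a pair of opposite arcs.
\<close>

definition closed_nbhd :: "'a pair_pre_digraph \<Rightarrow> 'a \<Rightarrow> 'a set" where
  "closed_nbhd G v = insert v {u. (v, u) \<in> parcs G}"


section \<open>The game Toggle\<close>

text \<open>The second component is the set of vertices of weight 0.\<close>

type_synonym 'a position = "'a pair_pre_digraph \<times> 'a set"

definition is_position :: "'a position \<Rightarrow> bool" where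
  "is_position = (\<lambda>(G, V0). pair_graph G \<and> V0 \<subseteq> pverts G)"

definition weight :: "'a position \<Rightarrow> 'a \<Rightarrow> nat" where
  "weight = (\<lambda>(G, V0) v. if v \<in> V0 then 0 else 1)"

definition sigma :: "'a position \<Rightarrow> 'a \<Rightarrow> nat" where
  "sigma S v = (\<Sum>u\<in>closed_nbhd (fst S) v. weight S u)"

definition switch :: "'a position \<Rightarrow> 'a \<Rightarrow> 'a position" where
  "switch = (\<lambda>(G, V0) v. (G, (V0 - closed_nbhd G v) \<union> (closed_nbhd G v - V0)))"

definition legal_move :: "'a position \<Rightarrow> 'a \<Rightarrow> bool" where
  "legal_move S v \<longleftrightarrow>
     v \<in> pverts (fst S) \<and> weight S v = 1 \<and> sigma (switch S v) v < sigma S v"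

definition options_of :: "'a position \<Rightarrow> 'a position set" where
  "options_of S = switch S ` {v. legal_move S v}"

definition mex :: "nat set \<Rightarrow> nat" where
  "mex T = (LEAST n. n \<notin> T)"

lemma weight_switch:
  "weight (switch S v) u =
     (if u \<in> closed_nbhd (fst S) v then 1 - weight S u else weight S u)"
  by (cases S) (auto simp: weight_def switch_def)

lemma closed_nbhd_subset:
  assumes "pair_graph G" "v \<in> pverts G"
  shows "closed_nbhd G v \<subseteq> pverts G"
proof -
  interpret pair_graph G by fact
  show ?thesis using assms(2) by (auto simp: closed_nbhd_def dest: in_arcsD2)
qed

lemma sigma_eq_card:
  assumes "finite (closed_nbhd G v)"
  shows "sigma (G, V0) v = card (closed_nbhd G v - V0)"
proof -
  have "sigma (G, V0) v = (\<Sum>u\<in>closed_nbhd G v. if u \<notin> V0 then 1 else 0)"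
    by (auto simp: sigma_def weight_def intro!: sum.cong)
  also have "\<dots> = card (closed_nbhd G v \<inter> {u. u \<notin> V0})"
    using assms by (simp add: sum.If_cases)
  also have "closed_nbhd G v \<inter> {u. u \<notin> V0} = closed_nbhd G v - V0" by auto
  finally show ?thesis .
qed

lemma is_position_option:
  assumes "is_position S" "S' \<in> options_of S"
  shows "is_position S'"
proof (cases S)
  case (Pair G V0)
  obtain v where "v \<in> pverts G" "S' = switch (G, V0) v"
    using assms(2) by (auto simp: Pair options_of_def legal_move_def)
  moreover have "pair_graph G" "V0 \<subseteq> pverts G"
    using assms(1) by (auto simp: Pair is_position_def)
  ultimately show ?thesis
    using closed_nbhd_subset[of G v] by (auto simp: is_position_def switch_def)
qed

lemma finite_options_of:
  assumes "is_position S"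
  shows "finite (options_of S)"
proof -
  interpret pair_graph "fst S" using assms by (auto simp: is_position_def)
  have "finite (pverts (fst S))" by (rule pair_finite_verts)
  then show ?thesis by (simp add: options_of_def legal_move_def)
qed

text \<open>Every legal move strictly decreases the number of vertices of weight 1.\<close>

lemma option_decreases:
  assumes "is_position (G, V0)" "(G', V0') \<in> options_of (G, V0)"
  shows "card (pverts G' - V0') < card (pverts G - V0)"
proof -
  obtain v where v: "legal_move (G, V0) v" and G': "G' = G"
    and V0': "V0' = (V0 - closed_nbhd G v) \<union> (closed_nbhd G v - V0)"
    using assms(2) by (auto simp: options_of_def switch_def)
  let ?N = "closed_nbhd G v"
  have G: "pair_graph G" using assms(1) by (simp add: is_position_def)
  then interpret pair_graph G .
  have N: "?N \<subseteq> pverts G" using v closed_nbhd_subset[OF G] by (simp add: legal_move_def)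
  have fin: "finite (pverts G)" by (rule pair_finite_verts)
  have finN: "finite ?N" using N fin by (rule finite_subset)
  have split: "card (pverts G - W) = card (?N - W) + card (pverts G - ?N - W)" for W
  proof -
    have "pverts G - W = (?N - W) \<union> (pverts G - ?N - W)" using N by auto
    moreover have "card ((?N - W) \<union> (pverts G - ?N - W)) = card (?N - W) + card (pverts G - ?N - W)"
      using fin finN by (intro card_Un_disjoint) auto
    ultimately show ?thesis by simp
  qed
  have "card (?N - V0') < card (?N - V0)"
    using v sigma_eq_card[OF finN] by (simp add: legal_move_def switch_def V0')
  moreover have "pverts G - ?N - V0' = pverts G - ?N - V0" by (auto simp: V0')
  ultimately show ?thesis using split[of V0] split[of V0'] by (simp add: G')
qed

text \<open>
  The guard ensures termination of the recursion on arbitrary arguments; on actual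
  positions it is discharged in \<open>nimber_eq_mex\<close> below.
\<close>

function nimber :: "'a position \<Rightarrow> nat" where
  "nimber S = (if is_position S then mex (nimber ` options_of S) else 0)"
  by pat_completeness auto
termination
  by (relation "measure (\<lambda>(G, V0). card (pverts G - V0))") (auto intro: option_decreases)

declare nimber.simps [simp del]

lemma nimber_eq_mex:
  assumes "is_position S"
  shows "nimber S = mex (nimber ` options_of S)"
  by (subst nimber.simps) (simp only: assms if_True)


section \<open>Ladders and prisms\<close>

text \<open>The pair \<open>(i, j)\<close> is the vertex \<open>v\<^sub>i\<^sub>,\<^sub>j\<close>, with row \<open>i\<close> and column \<open>j\<close>.\<close>

definition ladder :: "nat \<Rightarrow> (nat \<times> nat) pair_pre_digraph" where
  "ladder m =
    (let E = {((0, j), (1, j)) | j. 1 \<le> j \<and> j \<le> m} \<union>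
             {((i, j), (i, j + 1)) | i j. i \<le> 1 \<and> 1 \<le> j \<and> j < m}
     in \<lparr> pverts = {0..1} \<times> {1..m}, parcs = E \<union> E\<inverse> \<rparr>)"

definition prism :: "nat \<Rightarrow> (nat \<times> nat) pair_pre_digraph" where
  "prism m =
    (let E = {((0, 1), (0, m)), ((1, 1), (1, m))}
     in \<lparr> pverts = pverts (ladder m), parcs = parcs (ladder m) \<union> E \<union> E\<inverse> \<rparr>)"

definition H_position :: "nat \<Rightarrow> (nat \<times> nat) position" where
  "H_position m =
    (ladder m, {(0, 1), (0, m), (1, 1), (1, 2), (1, m - 1), (1, m)})"

lemma pair_graphI:
  assumes "finite (pverts G)" and "parcs G = E \<union> E\<inverse>"
    and "\<And>u v. (u, v) \<in> E \<Longrightarrow> u \<in> pverts G \<and> v \<in> pverts G \<and> u \<noteq> v"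
  shows "pair_graph G"
proof -
  have verts: "fst e \<in> pverts G" "snd e \<in> pverts G" and noloop: "fst e \<noteq> snd e"
    if "e \<in> parcs G" for e
    using that assms(3)[of "fst e" "snd e"] assms(3)[of "snd e" "fst e"] by (cases e; auto simp: assms(2))+
  have "parcs G \<subseteq> pverts G \<times> pverts G" using verts by (auto simp: mem_Times_iff)
  then have fin: "finite (parcs G)" using assms(1) by (meson finite_SigmaI finite_subset)
  have "sym (parcs G)" by (simp add: assms(2) sym_Un_converse)
  then have "symmetric (with_proj G)" by (simp add: symmetric_def)
  then show ?thesis using verts noloop fin assms(1) by unfold_locales
qed

lemma pair_graph_ladder: "pair_graph (ladder m)"
proof -
  define E :: "((nat \<times> nat) \<times> (nat \<times> nat)) set" where
    "E = {((0, j), (1, j)) | j. 1 \<le> j \<and> j \<le> m} \<union>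
         {((i, j), (i, j + 1)) | i j. i \<le> 1 \<and> 1 \<le> j \<and> j < m}"
  have verts: "pverts (ladder m) = {0..1} \<times> {1..m}" by (simp add: ladder_def Let_def)
  show ?thesis
  proof (rule pair_graphI)
    show "finite (pverts (ladder m))" by (simp add: verts)
    show "parcs (ladder m) = E \<union> E\<inverse>"
      by (simp only: ladder_def Let_def E_def pair_pre_digraph.simps)
    show "u \<in> pverts (ladder m) \<and> v \<in> pverts (ladder m) \<and> u \<noteq> v" if "(u, v) \<in> E" for u v
      using that unfolding verts by (auto simp: E_def)
  qed
qed

lemma pair_graph_prism:
  assumes "m \<ge> 3"
  shows "pair_graph (prism m)"
proof -
  define E :: "((nat \<times> nat) \<times> (nat \<times> nat)) set" where
    "E = {((0, j), (1, j)) | j. 1 \<le> j \<and> j \<le> m} \<union>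
         {((i, j), (i, j + 1)) | i j. i \<le> 1 \<and> 1 \<le> j \<and> j < m}"
  define F :: "((nat \<times> nat) \<times> (nat \<times> nat)) set" where
    "F = {((0, 1), (0, m)), ((1, 1), (1, m))}"
  have verts: "pverts (prism m) = {0..1} \<times> {1..m}" by (simp add: prism_def ladder_def Let_def)
  show ?thesis
  proof (rule pair_graphI)
    show "finite (pverts (prism m))" by (simp add: verts)
    have "parcs (prism m) = (E \<union> E\<inverse>) \<union> F \<union> F\<inverse>"
      by (simp only: prism_def ladder_def Let_def E_def F_def pair_pre_digraph.simps)
    then show "parcs (prism m) = (E \<union> F) \<union> (E \<union> F)\<inverse>" by blast
    show "u \<in> pverts (prism m) \<and> v \<in> pverts (prism m) \<and> u \<noteq> v" if "(u, v) \<in> E \<union> F" for u v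
      using that assms unfolding verts by (auto simp: E_def F_def)
  qed
qed

lemma is_position_prism:
  assumes "m \<ge> 3"
  shows "is_position (prism m, {})"
  using pair_graph_prism[OF assms] by (simp add: is_position_def)

lemma is_position_H_position:
  assumes "m \<ge> 4"
  shows "is_position (H_position m)"
proof -
  have "pverts (ladder m) = {0..1} \<times> {1..m}" by (simp add: ladder_def Let_def)
  moreover have "{(0, 1), (0, m), (1, 1), (1, 2), (1, m - 1), (1, m)} \<subseteq> {0..1::nat} \<times> {1..m}"
    using assms by simp
  ultimately show ?thesis
    using pair_graph_ladder[of m] by (simp only: is_position_def H_position_def prod.case simp_thms)
qed

end

theory Submission
  imports Defs
begin

text \<open>
  A legal move in the prism needs at most one zero in the closed neighborhood. Starting from
  weight 1 everywhere, the weight of an unplayed vertex is determined by the parity of its number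
  of played neighbors, so no played vertex ever has a played neighbor, and in fact no two played
  vertices lie in the same or in adjacent columns. Hence after a first move at \<open>c\<close> the column of
  \<open>c\<close> keeps weight 0 for the rest of the game. Cutting the prism along this column and doubling
  it gives a ladder with \<open>m + 1\<close> columns on which exactly the same moves are legal, and the
  position after the first move becomes \<open>\<H>\<^sub>m\<^sub>+\<^sub>1\<close>.
\<close>

section \<open>Nimbers of bisimilar positions\<close>

text \<open>Induction along the options of \<open>S\<close>: matched options have equal nimbers, so
  both sides are the mex of the same set.\<close>

lemma nimber_bisim:
  assumes "R S T"
    and pos: "\<And>S T. R S T \<Longrightarrow> is_position S \<and> is_position T"
    and fwd: "\<And>S T S'. R S T \<Longrightarrow> S' \<in> options_of S \<Longrightarrow> \<exists>T'\<in>options_of T. R S' T'"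
    and bwd: "\<And>S T T'. R S T \<Longrightarrow> T' \<in> options_of T \<Longrightarrow> \<exists>S'\<in>options_of S. R S' T'"
  shows "nimber S = nimber T"
  using assms(1)
proof (induction S arbitrary: T rule: nimber.induct)
  case (1 S)
  have IH: "nimber S' = nimber T'" if "S' \<in> options_of S" "R S' T'" for S' T'
    using 1 pos that by blast
  have "nimber ` options_of S = nimber ` options_of T"
  proof (intro equalityI subsetI)
    fix n assume "n \<in> nimber ` options_of S"
    then obtain S' where "S' \<in> options_of S" "n = nimber S'" by blast
    then show "n \<in> nimber ` options_of T"
      using fwd[OF 1(2)] IH by (metis image_eqI)
  next
    fix n assume "n \<in> nimber ` options_of T"
    then obtain T' where "T' \<in> options_of T" "n = nimber T'" by blast
    then show "n \<in> nimber ` options_of S"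
      using bwd[OF 1(2)] IH by (metis image_eqI)
  qed
  then show ?case using pos[OF 1(2)] by (simp add: nimber_eq_mex)
qed

text \<open>After the switch the vertices of weight 1 in the closed neighborhood are exactly its
  former zeros.\<close>

lemma legal_move_iff_card:
  assumes "finite (closed_nbhd G v)"
  shows "legal_move (G, V0) v \<longleftrightarrow> v \<in> pverts G \<and> v \<notin> V0 \<and>
    card (closed_nbhd G v \<inter> V0) < card (closed_nbhd G v - V0)"
proof -
  have "closed_nbhd G v - ((V0 - closed_nbhd G v) \<union> (closed_nbhd G v - V0)) = closed_nbhd G v \<inter> V0"
    by auto
  then show ?thesis
    using assms by (auto simp: legal_move_def weight_def switch_def sigma_eq_card)
qed

section \<open>Closed neighborhoods in ladder and prism\<close>

lemma pverts_ladder: "(i, j) \<in> pverts (ladder m) \<longleftrightarrow> i \<le> 1 \<and> 1 \<le> j \<and> j \<le> m"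
  by (auto simp: ladder_def Let_def)

lemma pverts_prism: "(i, j) \<in> pverts (prism m) \<longleftrightarrow> i \<le> 1 \<and> 1 \<le> j \<and> j \<le> m"
  by (simp add: prism_def Let_def pverts_ladder)

definition next_col :: "nat \<Rightarrow> nat \<Rightarrow> nat" where
  "next_col m j = (if j = m then 1 else j + 1)"

definition prev_col :: "nat \<Rightarrow> nat \<Rightarrow> nat" where
  "prev_col m j = (if j = 1 then m else j - 1)"

lemma next_prev_col:
  assumes "m \<ge> 3" "1 \<le> j" "j \<le> m"
  shows "1 \<le> next_col m j" "next_col m j \<le> m" "1 \<le> prev_col m j" "prev_col m j \<le> m"
    "next_col m (prev_col m j) = j" "prev_col m (next_col m j) = j"
    "next_col m j \<noteq> j" "prev_col m j \<noteq> j" "next_col m j \<noteq> prev_col m j"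
  using assms by (auto simp: next_col_def prev_col_def)

text \<open>Interior columns suffice: in the positions compared later both end columns hold only
  zeros, so no move is made there.\<close>

lemma closed_nbhd_ladder:
  assumes "i \<le> 1" "2 \<le> k" "k \<le> m"
  shows "closed_nbhd (ladder (m + 1)) (i, k) = {(i, k), (1 - i, k), (i, k + 1), (i, k - 1)}"
proof -
  have "((i, k), u) \<in> parcs (ladder (m + 1)) \<longleftrightarrow> u \<in> {(1 - i, k), (i, k + 1), (i, k - 1)}" for u
    using assms by (cases u) (auto simp: ladder_def Let_def le_Suc_eq)
  then show ?thesis by (auto simp: closed_nbhd_def)
qed

lemma closed_nbhd_prism:
  assumes "m \<ge> 3" "i \<le> 1" "1 \<le> j" "j \<le> m"
  shows "closed_nbhd (prism m) (i, j) = {(i, j), (1 - i, j), (i, next_col m j), (i, prev_col m j)}"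
proof -
  have "((i, j), u) \<in> parcs (prism m) \<longleftrightarrow>
      u \<in> {(1 - i, j), (i, next_col m j), (i, prev_col m j)}" for u
    using assms
    by (cases u) (auto simp: prism_def ladder_def Let_def next_col_def prev_col_def le_Suc_eq)
  then show ?thesis by (auto simp: closed_nbhd_def)
qed

section \<open>Sets of played vertices in the prism\<close>

text \<open>The vertices of weight 0 in the prism after the vertices in \<open>X\<close> have been played.\<close>

definition zeros :: "nat \<Rightarrow> (nat \<times> nat) set \<Rightarrow> (nat \<times> nat) set" where
  "zeros m X = {(i, j). (i, j) \<in> pverts (prism m) \<and>
     ((i, j) \<in> X \<or> ((1 - i, j) \<in> X) \<noteq> (((i, next_col m j) \<in> X) \<noteq> ((i, prev_col m j) \<in> X)))}"

text \<open>The invariant of play. Letting \<open>i'\<close> range over both rows excludes diagonal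
  pairs, which mere independence would allow.\<close>

definition sparse :: "nat \<Rightarrow> (nat \<times> nat) set \<Rightarrow> bool" where
  "sparse m X \<longleftrightarrow> X \<subseteq> pverts (prism m) \<and>
     (\<forall>(i, j)\<in>X. (1 - i, j) \<notin> X \<and> (\<forall>i'. (i', next_col m j) \<notin> X \<and> (i', prev_col m j) \<notin> X))"

lemma sparse_empty: "sparse m {}"
  by (simp add: sparse_def)

lemma zeros_empty: "zeros m {} = {}"
  by (auto simp: zeros_def)

text \<open>Among at most four vertices, two zeros leave at most two ones, so the sum would not
  drop.\<close>

lemma legal_move_at_most_one_zero:
  assumes "finite (closed_nbhd G v)" "card (closed_nbhd G v) \<le> 4" "legal_move (G, V0) v"
    and "x \<in> closed_nbhd G v \<inter> V0" "y \<in> closed_nbhd G v \<inter> V0"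
  shows "x = y"
proof (rule ccontr)
  let ?N = "closed_nbhd G v"
  assume "x \<noteq> y"
  then have "card {x, y} = 2" by simp
  moreover have "card {x, y} \<le> card (?N \<inter> V0)"
    using assms by (intro card_mono) auto
  moreover have "card (?N \<inter> V0) < card (?N - V0)"
    using assms by (simp add: legal_move_iff_card)
  moreover have "card ?N = card (?N \<inter> V0) + card (?N - V0)"
    using assms(1) by (metis card_Int_Diff)
  ultimately show False using assms(2) by simp
qed

lemma sparse_move:
  assumes m: "m \<ge> 3" and X: "sparse m X" and legal: "legal_move (prism m, zeros m X) (i, j)"
  shows "sparse m (insert (i, j) X)"
    and "switch (prism m, zeros m X) (i, j) = (prism m, zeros m (insert (i, j) X))"
proof -
  let ?Z = "zeros m X" and ?u = "1 - i" and ?n = "next_col m" and ?p = "prev_col m"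
  have i: "i \<le> 1" and j: "1 \<le> j" "j \<le> m"
    using legal by (auto simp: legal_move_def pverts_prism)
  have u: "?u \<le> 1" "1 - ?u = i" "?u \<noteq> i" using i by (auto simp: le_Suc_eq)
  note N = closed_nbhd_prism[OF m i j]
  note np = next_prev_col[OF m j]
  note npn = next_prev_col[OF m np(1,2)] and npp = next_prev_col[OF m np(3,4)]
  have one: "(i, j) \<notin> ?Z"
    using legal by (auto simp: legal_move_def weight_def split: if_splits)
  have fin: "finite (closed_nbhd (prism m) (i, j))" by (simp add: N)
  have "card (closed_nbhd (prism m) (i, j)) \<le> 4"
    using card_length[of "[(i, j), (?u, j), (i, ?n j), (i, ?p j)]"] by (simp add: N)
  note unique = legal_move_at_most_one_zero[OF fin this legal, unfolded N]
  have uniq: "\<not> ((?u, j) \<in> ?Z \<and> (i, ?n j) \<in> ?Z)" "\<not> ((?u, j) \<in> ?Z \<and> (i, ?p j) \<in> ?Z)"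
      "\<not> ((i, ?n j) \<in> ?Z \<and> (i, ?p j) \<in> ?Z)"
    using unique[of "(?u, j)" "(i, ?n j)"] unique[of "(?u, j)" "(i, ?p j)"]
      unique[of "(i, ?n j)" "(i, ?p j)"] np u by auto
  have XZ: "(a, b) \<in> ?Z" if "(a, b) \<in> X" for a b
    using that X by (auto simp: zeros_def sparse_def)
  have notX: "(i, j) \<notin> X" using one XZ by blast
  have "((?u, j) \<in> X) = (((i, ?n j) \<in> X) \<noteq> ((i, ?p j) \<in> X))"
    using one i j by (auto simp: zeros_def pverts_prism)
  \<comment> \<open>The number of played neighbors is even, so one played neighbor implies a second,
    and both would be zeros next to \<open>(i, j)\<close>.\<close>
  then have nbX: "(?u, j) \<notin> X" "(i, ?n j) \<notin> X" "(i, ?p j) \<notin> X"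
    using uniq XZ by blast+
  txt \<open>
    A played vertex diagonal to \<open>(i, j)\<close> turns its two common neighbors with \<open>(i, j)\<close> into zeros;
    the one in the row of \<open>(i, j)\<close> stays zero because its far neighbor is diagonal to that played
    vertex, and the other one can only be repaired by the second diagonal vertex, which then
    creates a zero on the other side of \<open>(i, j)\<close>.
  \<close>
  have zu: "(?u, j) \<in> ?Z \<longleftrightarrow> ((?u, ?n j) \<in> X) \<noteq> ((?u, ?p j) \<in> X)"
    using nbX notX u j by (simp add: zeros_def pverts_prism)
  have zn: "(i, ?n j) \<in> ?Z \<longleftrightarrow> ((?u, ?n j) \<in> X) \<noteq> ((i, ?n (?n j)) \<in> X)"
    using nbX notX i np by (simp add: zeros_def pverts_prism)
  have zp: "(i, ?p j) \<in> ?Z \<longleftrightarrow> ((?u, ?p j) \<in> X) \<noteq> ((i, ?p (?p j)) \<in> X)"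
    using nbX notX i np by (auto simp add: zeros_def pverts_prism)
  have dn: "(i, ?n (?n j)) \<notin> X" if "(?u, ?n j) \<in> X" using X that by (auto simp: sparse_def)
  have dp: "(i, ?p (?p j)) \<notin> X" if "(?u, ?p j) \<in> X" using X that by (auto simp: sparse_def)
  have diag: "(?u, ?n j) \<notin> X" "(?u, ?p j) \<notin> X"
    using zu zn zp dn dp uniq by blast+
  have rows: "a = i \<or> a = ?u" if "a \<le> 1" for a using that i by auto
  have free: "(a, j) \<notin> X" "(a, ?n j) \<notin> X" "(a, ?p j) \<notin> X" for a
    using rows[of a] notX nbX diag X by (auto simp: sparse_def pverts_prism)
  show "sparse m (insert (i, j) X)"
    unfolding sparse_def
  proof (intro conjI ballI)
    show "insert (i, j) X \<subseteq> pverts (prism m)"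
      using X i j by (simp add: sparse_def pverts_prism)
    fix v assume v: "v \<in> insert (i, j) X"
    show "case v of (a, b) \<Rightarrow> (1 - a, b) \<notin> insert (i, j) X \<and>
        (\<forall>i'. (i', ?n b) \<notin> insert (i, j) X \<and> (i', ?p b) \<notin> insert (i, j) X)"
    proof (cases "v = (i, j)")
      case True
      then show ?thesis using free np u by auto
    next
      case False
      obtain a b where ab: "v = (a, b)" by (cases v)
      then have vX: "(a, b) \<in> X" using False v by blast
      then have b: "a \<le> 1" "1 \<le> b" "b \<le> m" using X by (auto simp: sparse_def pverts_prism)
      have "b \<noteq> j" "b \<noteq> ?n j" "b \<noteq> ?p j" using vX free by auto
      then have "?n b \<noteq> j" "?p b \<noteq> j" using next_prev_col[OF m b(2,3)] by auto
      then show ?thesis using X vX \<open>b \<noteq> j\<close> by (auto simp: ab sparse_def)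
    qed
  qed
  \<comment> \<open>Each neighbor of \<open>(i, j)\<close> gains one played neighbor, which flips
    its parity; by \<open>free\<close> it is not played itself, so its membership in
    \<open>zeros\<close> flips too.\<close>
  have "(?Z - closed_nbhd (prism m) (i, j)) \<union> (closed_nbhd (prism m) (i, j) - ?Z)
      = zeros m (insert (i, j) X)" (is "?L = ?R")
  proof (rule set_eqI)
    fix v :: "nat \<times> nat"
    obtain a b where v: "v = (a, b)" by (cases v)
    show "v \<in> ?L \<longleftrightarrow> v \<in> ?R"
    proof (cases "v \<in> pverts (prism m)")
      case False
      moreover have "closed_nbhd (prism m) (i, j) \<subseteq> pverts (prism m)"
        using closed_nbhd_subset[OF pair_graph_prism[OF m]] i j by (simp add: pverts_prism)
      ultimately show ?thesis by (auto simp: v zeros_def)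
    next
      case True
      then have a: "a \<le> 1" and b: "1 \<le> b" "b \<le> m" by (auto simp: v pverts_prism)
      note npb = next_prev_col[OF m b]
      consider "v = (i, j)" | "v = (?u, j)" | "v = (i, ?n j)" | "v = (i, ?p j)"
        | "v \<notin> closed_nbhd (prism m) (i, j)" by (auto simp: N)
      then show ?thesis
      proof cases
        case 1
        then show ?thesis using one True by (simp add: N) (simp add: zeros_def)
      next
        case 2
        then show ?thesis
          using True u np free zu by (simp add: N) (simp add: zeros_def)
      next
        case 3
        then show ?thesis
          using True u np npn free zn by (simp add: N) (auto simp: zeros_def)
      next
        case 4
        then show ?thesis
          using True u np npp free zp by (simp add: N) (auto simp: zeros_def)
      next
        case 5
        have "(1 - a, b) \<noteq> (i, j)" "(a, ?n b) \<noteq> (i, j)" "(a, ?p b) \<noteq> (i, j)" "(a, b) \<noteq> (i, j)"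
          using 5 a npb by (auto simp: N v)
        then show ?thesis using 5 by (auto simp: v zeros_def)
      qed
    qed
  qed
  then show "switch (prism m, ?Z) (i, j) = (prism m, zeros m (insert (i, j) X))"
    by (simp add: switch_def)
qed

text \<open>A played vertex stays zero, and the vertex across its rung has exactly one played
  neighbor because the adjacent columns contain none.\<close>

lemma sparse_column_zero:
  assumes "m \<ge> 3" "sparse m X" "(i, j) \<in> X" "i' \<le> 1"
  shows "(i', j) \<in> zeros m X"
proof -
  have "i \<le> 1" "1 \<le> j" "j \<le> m" using assms by (auto simp: sparse_def pverts_prism)
  moreover have "i' = i \<or> i' = 1 - i" using assms \<open>i \<le> 1\<close> by auto
  ultimately show ?thesis using assms by (auto simp: sparse_def zeros_def pverts_prism)
qed

section \<open>Winding the ladder around the prism\<close>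

text \<open>
  Winds the ladder with \<open>m + 1\<close> columns once around the prism, starting and ending in the
  column of \<open>c\<close>; row 1 of the ladder lands in the row of \<open>c\<close>.
\<close>

fun wind :: "nat \<Rightarrow> nat \<times> nat \<Rightarrow> nat \<times> nat \<Rightarrow> nat \<times> nat" where
  "wind m (i0, j0) (i, k) =
     (if i0 = 1 then i else 1 - i, if j0 + k \<le> m + 1 then j0 + k - 1 else j0 + k - 1 - m)"

declare wind.simps [simp del]

context
  fixes m i0 j0 :: nat
  assumes m: "m \<ge> 3" and c: "(i0, j0) \<in> pverts (prism m)"
begin

abbreviation "w \<equiv> wind m (i0, j0)"

lemma base_column: "i0 \<le> 1" "1 \<le> j0" "j0 \<le> m"
  using c by (auto simp: pverts_prism)

lemma wind_in_prism:
  assumes "v \<in> pverts (ladder (m + 1))"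
  shows "w v \<in> pverts (prism m)"
  using assms base_column by (cases v) (auto simp: wind.simps pverts_ladder pverts_prism)

text \<open>The ladder goes around once, so only the two end columns, a full turn of
  \<open>m\<close> apart, are identified.\<close>

lemma wind_eqD:
  assumes "(i, k) \<in> pverts (ladder (m + 1))" "(i', k') \<in> pverts (ladder (m + 1))"
    and "w (i, k) = w (i', k')"
  shows "i = i'" and "k = k' \<or> k + m = k' \<or> k' + m = k"
proof -
  show "i = i'" using assms by (auto simp: wind.simps pverts_ladder split: if_splits)
  have "(if j0 + k \<le> m + 1 then j0 + k - 1 else j0 + k - 1 - m) =
      (if j0 + k' \<le> m + 1 then j0 + k' - 1 else j0 + k' - 1 - m)"
    using assms(3) by (simp add: wind.simps)
  then show "k = k' \<or> k + m = k' \<or> k' + m = k"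
    using assms(1,2) base_column unfolding pverts_ladder by (simp split: if_splits; arith)
qed

lemma wind_inj:
  assumes "i \<le> 1" "2 \<le> k" "k \<le> m" "v \<in> pverts (ladder (m + 1))" "w (i, k) = w v"
  shows "v = (i, k)"
  using assms wind_eqD[of i k "fst v" "snd v"] by (cases v) (auto simp: pverts_ladder)

lemma wind_surj:
  assumes "(i, j) \<in> pverts (prism m)" "j \<noteq> j0"
  obtains i' k where "i' \<le> 1" "2 \<le> k" "k \<le> m" "w (i', k) = (i, j)"
proof
  \<comment> \<open>The witness inverts the winding: column \<open>k\<close> lies
    \<open>k - 1\<close> steps after \<open>j0\<close>, so \<open>m\<close> is added when
    \<open>j\<close> precedes \<open>j0\<close>.\<close>
  show "w (if i0 = 1 then i else 1 - i, if j0 < j then j + 1 - j0 else j + 1 + m - j0) = (i, j)"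
    "(if i0 = 1 then i else 1 - i) \<le> 1"
    "2 \<le> (if j0 < j then j + 1 - j0 else j + 1 + m - j0)"
    "(if j0 < j then j + 1 - j0 else j + 1 + m - j0) \<le> m"
    using assms base_column by (auto simp: wind.simps pverts_prism)
qed

lemma wind_end_columns: "snd (w (i, 1)) = j0" "snd (w (i, m + 1)) = j0"
  using base_column by (auto simp: wind.simps)

text \<open>Winding is a local isomorphism at interior columns. It is injective there since a closed
  neighborhood spans three columns, too few for a full turn of \<open>m\<close> \<ge> 3.\<close>

lemma wind_closed_nbhd:
  assumes "i \<le> 1" "2 \<le> k" "k \<le> m"
  shows "closed_nbhd (prism m) (w (i, k)) = w ` closed_nbhd (ladder (m + 1)) (i, k)"
    and "inj_on w (closed_nbhd (ladder (m + 1)) (i, k))"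
proof -
  obtain a b where ab: "w (i, k) = (a, b)" by (cases "w (i, k)")
  have L: "(i, k) \<in> pverts (ladder (m + 1))" using assms by (simp add: pverts_ladder)
  have P: "a \<le> 1" "1 \<le> b" "b \<le> m" using wind_in_prism[OF L] by (auto simp: ab pverts_prism)
  have "w (1 - i, k) = (1 - a, b)" "w (i, k + 1) = (a, next_col m b)" "w (i, k - 1) = (a, prev_col m b)"
    using ab assms base_column m by (auto simp: wind.simps next_col_def prev_col_def split: if_splits)
  then show "closed_nbhd (prism m) (w (i, k)) = w ` closed_nbhd (ladder (m + 1)) (i, k)"
    unfolding closed_nbhd_ladder[OF assms] ab closed_nbhd_prism[OF m P] by (simp add: ab)
  show "inj_on w (closed_nbhd (ladder (m + 1)) (i, k))"
  proof (rule inj_onI)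
    fix u v
    assume N: "u \<in> closed_nbhd (ladder (m + 1)) (i, k)" "v \<in> closed_nbhd (ladder (m + 1)) (i, k)"
      and "w u = w v"
    obtain x y x' y' where uv: "u = (x, y)" "v = (x', y')" by (cases u, cases v)
    have "u \<in> pverts (ladder (m + 1))" "v \<in> pverts (ladder (m + 1))"
      using closed_nbhd_subset[OF pair_graph_ladder L] N by auto
    then have "x = x'" "y = y' \<or> y + m = y' \<or> y' + m = y"
      using wind_eqD \<open>w u = w v\<close> uv by blast+
    moreover have "k - 1 \<le> y" "y \<le> k + 1" "k - 1 \<le> y'" "y' \<le> k + 1"
      using N unfolding closed_nbhd_ladder[OF assms] uv by auto
    ultimately show "u = v" using m uv by auto
  qed
qed

definition unwound :: "(nat \<times> nat) set \<Rightarrow> (nat \<times> nat) set" where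
  "unwound V = {v \<in> pverts (ladder (m + 1)). w v \<in> V}"

text \<open>Legality depends only on the closed neighborhood, which the winding maps
  bijectively.\<close>

lemma legal_move_unwound:
  assumes "i \<le> 1" "2 \<le> k" "k \<le> m"
  shows "legal_move (ladder (m + 1), unwound V) (i, k) \<longleftrightarrow> legal_move (prism m, V) (w (i, k))"
proof -
  let ?N = "closed_nbhd (ladder (m + 1)) (i, k)"
  have fin: "finite ?N" unfolding closed_nbhd_ladder[OF assms] by simp
  have v: "(i, k) \<in> pverts (ladder (m + 1))" using assms by (simp add: pverts_ladder)
  have sub: "?N \<subseteq> pverts (ladder (m + 1))"
    using closed_nbhd_subset[OF pair_graph_ladder v] .
  have "w ` (?N \<inter> unwound V) = w ` ?N \<inter> V" "w ` (?N - unwound V) = w ` ?N - V"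
    using sub by (auto simp: unwound_def)
  moreover have "card (w ` (?N \<inter> unwound V)) = card (?N \<inter> unwound V)"
    "card (w ` (?N - unwound V)) = card (?N - unwound V)"
    using wind_closed_nbhd(2)[OF assms] by (auto intro!: card_image intro: inj_on_subset)
  ultimately show ?thesis
    using fin v wind_in_prism[OF v]
    by (simp add: legal_move_iff_card wind_closed_nbhd(1)[OF assms]) (simp add: unwound_def)
qed

text \<open>A switch reaching column \<open>j0\<close> would affect both end columns of the
  pulled-back position, but the ladder move only one; \<open>col\<close> rules this out.\<close>

lemma switch_unwound:
  assumes ik: "i \<le> 1" "2 \<le> k" "k \<le> m"
    and switched: "switch (prism m, V) (w (i, k)) = (prism m, V')"
    and col: "\<And>a. a \<le> 1 \<Longrightarrow> (a, j0) \<in> V \<and> (a, j0) \<in> V'"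
  shows "switch (ladder (m + 1), unwound V) (i, k) = (ladder (m + 1), unwound V')"
proof -
  let ?N = "closed_nbhd (ladder (m + 1)) (i, k)"
  have V': "V' = (V - w ` ?N) \<union> (w ` ?N - V)"
    using switched by (simp add: switch_def wind_closed_nbhd(1)[OF ik])
  have v: "(i, k) \<in> pverts (ladder (m + 1))" using ik by (simp add: pverts_ladder)
  have sub: "?N \<subseteq> pverts (ladder (m + 1))"
    using closed_nbhd_subset[OF pair_graph_ladder v] .
  have "w u \<in> w ` ?N \<longleftrightarrow> u \<in> ?N" if u: "u \<in> pverts (ladder (m + 1))" for u
  proof -
    obtain a b where ab: "u = (a, b)" by (cases u)
    show ?thesis
    proof (cases "2 \<le> b \<and> b \<le> m")
      case True
      then show ?thesis using wind_inj[of a b] u sub by (auto simp: ab pverts_ladder)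
    next
      case False
      then have "b = 1 \<or> b = m + 1" using u by (auto simp: ab pverts_ladder)
      then have "snd (w u) = j0" using wind_end_columns by (auto simp: ab)
      moreover have "fst (w u) \<le> 1"
        using wind_in_prism[OF u] by (cases "w u") (auto simp: pverts_prism)
      ultimately have "w u \<in> V" "w u \<in> V'" using col[of "fst (w u)"] by (metis prod.collapse)+
      \<comment> \<open>A vertex that is zero both before and after the switch was not
        switched.\<close>
      then have "w u \<notin> w ` ?N" by (auto simp: V')
      then show ?thesis by blast
    qed
  qed
  then have "(unwound V - ?N) \<union> (?N - unwound V) = unwound V'"
    using sub by (auto simp: unwound_def V')
  then show ?thesis by (simp add: switch_def)
qed

section \<open>Bisimulation between prism and ladder\<close>

definition winds_to :: "(nat \<times> nat) position \<Rightarrow> (nat \<times> nat) position \<Rightarrow> bool" where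
  "winds_to S T \<longleftrightarrow> (\<exists>X. sparse m X \<and> (i0, j0) \<in> X \<and>
     S = (prism m, zeros m X) \<and> T = (ladder (m + 1), unwound (zeros m X)))"

lemma winds_to_move:
  assumes "sparse m X" "(i0, j0) \<in> X" "i \<le> 1" "2 \<le> k" "k \<le> m"
    and "legal_move (prism m, zeros m X) (w (i, k))"
  shows "winds_to (switch (prism m, zeros m X) (w (i, k)))
    (switch (ladder (m + 1), unwound (zeros m X)) (i, k))"
proof -
  obtain a b where ab: "w (i, k) = (a, b)" by (cases "w (i, k)")
  let ?Y = "insert (a, b) X"
  have Y: "sparse m ?Y" and sw: "switch (prism m, zeros m X) (w (i, k)) = (prism m, zeros m ?Y)"
    using sparse_move[OF m assms(1)] assms(6) by (simp_all add: ab)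
  have "switch (ladder (m + 1), unwound (zeros m X)) (i, k) = (ladder (m + 1), unwound (zeros m ?Y))"
    using assms sw Y sparse_column_zero[OF m] by (intro switch_unwound) auto
  then show ?thesis
    unfolding winds_to_def using Y sw assms(2) by auto
qed

lemma nimber_winds_to:
  assumes "winds_to S T"
  shows "nimber S = nimber T"
  using assms
proof (rule nimber_bisim)
  fix S T assume "winds_to S T"
  then obtain X where X: "sparse m X" "(i0, j0) \<in> X"
    and S: "S = (prism m, zeros m X)" and T: "T = (ladder (m + 1), unwound (zeros m X))"
    by (auto simp: winds_to_def)
  show "is_position S \<and> is_position T"
    using pair_graph_prism[OF m] pair_graph_ladder
    by (auto simp: S T is_position_def unwound_def zeros_def)
  have zero: "(a, j0) \<in> zeros m X" if "a \<le> 1" for a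
    using sparse_column_zero[OF m X that] .
  show "\<exists>T'\<in>options_of T. winds_to S' T'" if S': "S' \<in> options_of S" for S'
  proof -
    obtain a b where ab: "legal_move S (a, b)" "S' = switch S (a, b)"
      using S' by (auto simp: options_of_def)
    then have "(a, b) \<in> pverts (prism m)" "(a, b) \<notin> zeros m X"
      by (auto simp: S legal_move_def weight_def split: if_splits)
    \<comment> \<open>Column \<open>j0\<close> is all zero, so the move lies in another column,
      where the winding is onto.\<close>
    then obtain i k where ik: "i \<le> 1" "2 \<le> k" "k \<le> m" "w (i, k) = (a, b)"
      using zero by (metis pverts_prism wind_surj)
    then have "legal_move T (i, k)"
      using ab legal_move_unwound[of i k] by (simp add: S T)
    moreover have "winds_to S' (switch T (i, k))"
      using winds_to_move[OF X ik(1-3)] ab ik(4) by (simp add: S T)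
    ultimately show ?thesis by (auto simp: options_of_def)
  qed
  show "\<exists>S'\<in>options_of S. winds_to S' T'" if T': "T' \<in> options_of T" for T'
  proof -
    obtain i k where ik: "legal_move T (i, k)" "T' = switch T (i, k)"
      using T' by (auto simp: options_of_def)
    then have v: "(i, k) \<in> pverts (ladder (m + 1))" "w (i, k) \<notin> zeros m X"
      by (auto simp: T legal_move_def weight_def unwound_def split: if_splits)
    have "fst (w (i, k)) \<le> 1"
      using wind_in_prism[OF v(1)] by (cases "w (i, k)") (auto simp: pverts_prism)
    then have "snd (w (i, k)) \<noteq> j0" using v(2) zero by (metis prod.collapse)
    then have "k \<noteq> 1" "k \<noteq> m + 1" using wind_end_columns by auto
    then have k: "i \<le> 1" "2 \<le> k" "k \<le> m" using v(1) by (auto simp: pverts_ladder)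
    have "legal_move S (w (i, k))"
      using ik legal_move_unwound[OF k] by (simp add: S T)
    moreover from this have "winds_to (switch S (w (i, k))) T'"
      using winds_to_move[OF X k] ik by (simp add: S T)
    ultimately show ?thesis unfolding options_of_def by blast
  qed
qed

text \<open>The column of the first move appears at both ends, giving four zeros; its horizontal
  neighbors become \<open>(1, 2)\<close> and \<open>(1, m)\<close> because row 1 lands in row
  \<open>i0\<close>.\<close>

lemma unwound_first_move:
  "(ladder (m + 1), unwound (closed_nbhd (prism m) (i0, j0))) = H_position (m + 1)"
proof -
  have "v \<in> unwound (closed_nbhd (prism m) (i0, j0)) \<longleftrightarrow>
      v \<in> {(0, 1), (0, m + 1), (1, 1), (1, 2), (1, m), (1, m + 1)}" for v
  proof (cases "v \<in> pverts (ladder (m + 1))")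
    case False
    then show ?thesis using m by (cases v) (auto simp: unwound_def pverts_ladder)
  next
    case v: True
    obtain a b where ab: "v = (a, b)" by (cases v)
    have a: "a \<le> 1" and b: "1 \<le> b" "b \<le> m + 1" using v by (auto simp: ab pverts_ladder)
    have "w v = (i0, j0) \<or> w v = (1 - i0, j0) \<longleftrightarrow> b = 1 \<or> b = m + 1"
      using a b base_column by (auto simp: ab wind.simps)
    moreover have "w (1, 2) = (i0, next_col m j0)" "w (1, m) = (i0, prev_col m j0)"
      using base_column m by (auto simp: wind.simps next_col_def prev_col_def)
    then have "w v = (i0, next_col m j0) \<longleftrightarrow> v = (1, 2)" "w v = (i0, prev_col m j0) \<longleftrightarrow> v = (1, m)"
      using wind_inj[of 1 2 v] wind_inj[of 1 m v] v m by auto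
    ultimately have "v \<in> unwound (closed_nbhd (prism m) (i0, j0)) \<longleftrightarrow>
        (b = 1 \<or> b = m + 1) \<or> v = (1, 2) \<or> v = (1, m)"
      unfolding unwound_def closed_nbhd_prism[OF m base_column] using v by auto
    then show ?thesis using a by (auto simp: ab le_Suc_eq)
  qed
  then have "unwound (closed_nbhd (prism m) (i0, j0)) =
      {(0, 1), (0, m + 1), (1, 1), (1, 2), (1, m), (1, m + 1)}" by blast
  then show ?thesis by (simp add: H_position_def)
qed

end

section \<open>First moves on the full prism\<close>

text \<open>Without zeros every vertex is playable, and winding from whichever vertex is played
  always gives the same ladder position.\<close>

lemma options_of_full_prism:
  assumes m: "m \<ge> 3"
  shows "nimber ` options_of (prism m, {}) = {nimber (H_position (m + 1))}"
proof -
  have legal: "legal_move (prism m, {}) (i, j) \<longleftrightarrow> (i, j) \<in> pverts (prism m)" for i j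
  proof (cases "(i, j) \<in> pverts (prism m)")
    case True
    then have "closed_nbhd (prism m) (i, j) = {(i, j), (1 - i, j), (i, next_col m j), (i, prev_col m j)}"
      using closed_nbhd_prism[OF m] by (simp add: pverts_prism)
    then show ?thesis
      using True by (simp add: legal_move_iff_card card_gt_0_iff)
  next
    case False
    then show ?thesis by (simp add: legal_move_def)
  qed
  have same: "nimber (switch (prism m, {}) (i, j)) = nimber (H_position (m + 1))"
    if "(i, j) \<in> pverts (prism m)" for i j
  proof -
    have "sparse m {(i, j)}" "switch (prism m, {}) (i, j) = (prism m, zeros m {(i, j)})"
      using sparse_move[OF m sparse_empty, of i j] legal that by (auto simp: zeros_empty)
    moreover from this have "zeros m {(i, j)} = closed_nbhd (prism m) (i, j)"
      by (simp add: switch_def)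
    ultimately have "winds_to m i j (switch (prism m, {}) (i, j)) (H_position (m + 1))"
      using unwound_first_move[OF m that] by (auto simp: winds_to_def[OF m that])
    then show ?thesis by (rule nimber_winds_to[OF m that])
  qed
  have "(0, 1) \<in> pverts (prism m)" using m by (simp add: pverts_prism)
  then have "(\<lambda>v. nimber (switch (prism m, {}) v)) ` pverts (prism m) = {nimber (H_position (m + 1))}"
    using same by force
  moreover have "{v. legal_move (prism m, {}) v} = pverts (prism m)" using legal by auto
  ultimately show ?thesis by (simp add: options_of_def image_image)
qed

theorem proposition3p1:
  fixes m :: nat and x :: "nat \<Rightarrow> nat"
  assumes "m \<ge> 3"
    and "\<forall>i\<in>{1..2 * m}. x i = nimber (H_position (m + 1))"
  shows "nimber (prism m, {}) = mex {x i | i. i \<in> {1..2 * m}}"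
proof -
  \<comment> \<open>A nonempty index range makes the set of values a singleton rather than
    empty.\<close>
  have "m \<in> {1..2 * m}" using assms(1) by simp
  then have "{x i | i. i \<in> {1..2 * m}} = {nimber (H_position (m + 1))}"
    using assms(2) by force
  then show ?thesis
    using nimber_eq_mex[OF is_position_prism] options_of_full_prism assms(1) by simp
qed

end
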